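(* Let $v$ be a vertex of a graph $G=(V,E)$, let $T=T_v(G)$ be the path tree of $G$ with respect to $v$, and let $\mu_V(T)=\mu_V^{\phi_v}(T)$ denote its relative vertex matching polynomial with respect to the labeling $\phi_v:T\to G$. Then $$\frac{\mu_V(G)}{\mu_V(G\setminus v)}=\frac{\mu_V(T)}{\mu_V(T\setminus v)},$$ where $T\setminus v$ is $T$ with its root (labeled $v$) removed and $\mu_V(T\setminus v)$ is its relative vertex matching polynomial with respect to the restriction of $\phi_v$. Further, $\mu_V(G)$ divides $\mu_V(T)$.
   Context: All graphs are finite, simple and undirected. The vertex matching polynomial of a graph $G=(V,E)$ is $\mu_V(G)(\mathbf{x}) := \sum_{M\subseteq E,\ M\text{ matching}}\ \prod_{\{u,w\}\in M}(-x_ux_w)$, in variables $(x_u)_{u\in V}$ (the empty matching contributes $1$). Given a graph homomorphism $\phi:H\to G$ (a labeling of $H$ by $G$), the relative vertex matching polynomial of $H$ is $\mu_V^{\phi}(H)(\mathbf{x}):=\sum_{M\subseteq E(H),\ M\text{ matching}}\ \prod_{\{u,w\}\in M}(-x_{\phi(u)}x_{\phi(w)})$, in variables indexed by $V(G)$. The labeled path tree $T_v(G)$ is defined recursively: if $G$ is a tree, $T_v(G)=G$ with root $v$, each vertex labeled by itself. For arbitrary $G$, take the disjoint union of the labeled rooted trees $T_w(G\setminus\{v\})$ over all neighbors $w$ of $v$, and add a new vertex (the root) labeled $v$ joined by an edge to the root of each of these trees. (Thus the vertices of $T_v(G)$ correspond to the self-avoiding paths in $G$ starting at $v$, each labeled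 by its endpoint.) The labels define a graph homomorphism $\phi_v:T_v(G)\to G$.
   Formalization: The claim that μ_V(G) divides μ_V(T) is stated only for connected G; it fails otherwise, e.g. v isolated and one further edge {a,b}: μ_V(T)=1 but μ_V(G)=1−x_a x_b. The quotient identity is stated for every G. *)

theory Defs
  imports
    "HOL-Library.Poly_Mapping"
    "HOL-Computational_Algebra.Fraction_Field"
begin

section \<open>Multivariate polynomials\<close>

text \<open>
  Polynomials with coefficients in \<open>'c\<close> and variables indexed by an arbitrary type \<open>'v\<close>: finitely
  supported maps from monomials to coefficients, with the convolution product of
  \<^theory>\<open>HOL-Library.Poly_Mapping\<close>.  They are wrapped in a type of their own because the library's
  \<^class>\<open>idom\<close> instance, which is needed to form the fraction field, demands a linear order on \<open>'v\<close>.
\<close>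

typedef (overloaded) ('v, 'c) mpoly = "UNIV :: (('v \<Rightarrow>\<^sub>0 nat) \<Rightarrow>\<^sub>0 'c::comm_ring_1) set"
  by simp

setup_lifting type_definition_mpoly

instantiation mpoly :: (type, comm_ring_1) comm_ring_1
begin

lift_definition zero_mpoly :: "('a, 'b) mpoly" is 0 .
lift_definition one_mpoly :: "('a, 'b) mpoly" is 1 .
lift_definition plus_mpoly :: "('a, 'b) mpoly \<Rightarrow> ('a, 'b) mpoly \<Rightarrow> ('a, 'b) mpoly" is plus .
lift_definition minus_mpoly :: "('a, 'b) mpoly \<Rightarrow> ('a, 'b) mpoly \<Rightarrow> ('a, 'b) mpoly" is minus .
lift_definition uminus_mpoly :: "('a, 'b) mpoly \<Rightarrow> ('a, 'b) mpoly" is uminus .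
lift_definition times_mpoly :: "('a, 'b) mpoly \<Rightarrow> ('a, 'b) mpoly \<Rightarrow> ('a, 'b) mpoly" is times .

instance
  by standard (transfer; simp add: algebra_simps)+

end

lift_definition Var :: "'v \<Rightarrow> ('v, 'c::comm_ring_1) mpoly"
  is "\<lambda>u. Poly_Mapping.single (Poly_Mapping.single u 1) 1" .

definition mcoeff :: "('v, 'c::comm_ring_1) mpoly \<Rightarrow> ('v \<Rightarrow>\<^sub>0 nat) \<Rightarrow> 'c" where
  "mcoeff p m = Poly_Mapping.lookup (Rep_mpoly p) m"

lemma lookup_times_unique:
  fixes f g :: "'a::comm_monoid_add \<Rightarrow>\<^sub>0 'c::comm_ring_1"
  assumes "\<And>a b. Poly_Mapping.lookup f a \<noteq> 0 \<Longrightarrow> Poly_Mapping.lookup g b \<noteq> 0 \<Longrightarrow> a + b = a0 + b0 \<Longrightarrow> a = a0 \<and> b = b0"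
  shows "Poly_Mapping.lookup (f * g) (a0 + b0) = Poly_Mapping.lookup f a0 * Poly_Mapping.lookup g b0"
proof -
  let ?h = "\<lambda>(a, b). Poly_Mapping.lookup f a * Poly_Mapping.lookup g b when a0 + b0 = a + b"
  have "Poly_Mapping.lookup (f * g) (a0 + b0) = Sum_any ?h"
    by (simp add: times_poly_mapping.rep_eq prod_fun_unfold_prod)
  also have "\<dots> = sum ?h {(a0, b0)}"
    using assms by (intro Sum_any.expand_superset) (auto simp: when_def, (metis mult_zero_left mult_zero_right)+)
  finally show ?thesis by simp
qed

text \<open>
  No zero divisors: only finitely many variables occur in two given polynomials, so it suffices to
  order those.
\<close>

lemma mpoly_times_neq_0:
  fixes f g :: "('v \<Rightarrow>\<^sub>0 nat) \<Rightarrow>\<^sub>0 'c::idom"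
  assumes "f \<noteq> 0" "g \<noteq> 0"
  shows "f * g \<noteq> 0"
proof -
  define W where "W = (\<Union>m\<in>Poly_Mapping.keys f \<union> Poly_Mapping.keys g. Poly_Mapping.keys m)"
  have "finite W" by (auto simp: W_def)
  then obtain ix :: "'v \<Rightarrow> nat" where ix: "inj_on ix W"
    using finite_imp_inj_to_nat_seg by blast
  define h :: "('v \<Rightarrow>\<^sub>0 nat) \<Rightarrow> nat \<Rightarrow>\<^sub>0 nat" where "h m = (\<Sum>u\<in>W. Poly_Mapping.single (ix u) (Poly_Mapping.lookup m u))" for m
  have h_add: "h (m + n) = h m + h n" for m n
    by (simp add: h_def lookup_add single_add sum.distrib)
  have h_lookup: "Poly_Mapping.lookup (h m) (ix w) = Poly_Mapping.lookup m w" if "w \<in> W" for m w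
  proof -
    have "Poly_Mapping.lookup (h m) (ix w) = (\<Sum>u\<in>W. (Poly_Mapping.lookup m u when ix u = ix w))"
      by (simp add: h_def lookup_sum lookup_single)
    also have "\<dots> = (\<Sum>u\<in>W. if u = w then Poly_Mapping.lookup m u else 0)"
      using that ix by (intro sum.cong) (auto simp: when_def inj_on_def)
    finally show ?thesis using that \<open>finite W\<close> by simp
  qed
  have h_inj: "m = n" if "m \<in> Poly_Mapping.keys f \<union> Poly_Mapping.keys g" "n \<in> Poly_Mapping.keys f \<union> Poly_Mapping.keys g" "h m = h n" for m n
  proof (rule poly_mapping_eqI)
    fix u
    show "Poly_Mapping.lookup m u = Poly_Mapping.lookup n u"
    proof (cases "u \<in> W")
      case True
      thus ?thesis using h_lookup[of u m] h_lookup[of u n] that(3) by simp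
    next
      case False
      hence "u \<notin> Poly_Mapping.keys m" "u \<notin> Poly_Mapping.keys n" using that unfolding W_def by blast+
      thus ?thesis by (simp add: in_keys_iff)
    qed
  qed
  have ex_max: "\<exists>a\<in>A. \<forall>b\<in>A. h b \<le> h a" if "finite A" "A \<noteq> {}" for A
  proof -
    have "Max (h ` A) \<in> h ` A" using that by (intro Max_in) auto
    then obtain a where "a \<in> A" "h a = Max (h ` A)" by force
    thus ?thesis using that by (intro bexI[of _ a] ballI) simp_all
  qed
  obtain a0 where a0: "a0 \<in> Poly_Mapping.keys f" "\<forall>b\<in>Poly_Mapping.keys f. h b \<le> h a0"
    using ex_max[of "Poly_Mapping.keys f"] assms by auto
  obtain b0 where b0: "b0 \<in> Poly_Mapping.keys g" "\<forall>b\<in>Poly_Mapping.keys g. h b \<le> h b0"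
    using ex_max[of "Poly_Mapping.keys g"] assms by auto
  have "Poly_Mapping.lookup (f * g) (a0 + b0) = Poly_Mapping.lookup f a0 * Poly_Mapping.lookup g b0"
  proof (rule lookup_times_unique)
    fix a b assume nz: "Poly_Mapping.lookup f a \<noteq> 0" "Poly_Mapping.lookup g b \<noteq> 0" and eq: "a + b = a0 + b0"
    have le: "h a \<le> h a0" "h b \<le> h b0"
      using a0 b0 nz by (simp_all add: in_keys_iff)
    have sum: "h a + h b = h a0 + h b0"
      using arg_cong[OF eq, of h] by (simp add: h_add)
    have "h a = h a0" "h b = h b0"
      using le sum add_less_le_mono[of "h a" "h a0" "h b" "h b0"]
        add_le_less_mono[of "h a" "h a0" "h b" "h b0"]
      by (auto simp: order_le_less)
    thus "a = a0 \<and> b = b0"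
      using h_inj a0(1) b0(1) nz by (auto simp: in_keys_iff)
  qed
  moreover have "Poly_Mapping.lookup f a0 * Poly_Mapping.lookup g b0 \<noteq> 0"
    using a0(1) b0(1) by (simp add: in_keys_iff)
  ultimately show ?thesis by auto
qed

instance mpoly :: (type, idom) idom
  by standard (transfer, rule mpoly_times_neq_0)


section \<open>Graphs\<close>

record 'v ugraph =
  verts :: "'v set"
  edges :: "'v set set"

definition simple_graph :: "'v ugraph \<Rightarrow> bool" where
  "simple_graph G \<longleftrightarrow> finite (verts G) \<and> edges G \<subseteq> {e. e \<subseteq> verts G \<and> card e = 2}"

definition neighbours :: "'v ugraph \<Rightarrow> 'v \<Rightarrow> 'v set" where
  "neighbours G v = {w. {v, w} \<in> edges G}"

definition del_vertex :: "'v ugraph \<Rightarrow> 'v \<Rightarrow> 'v ugraph" (infixl \<open>\<setminus>\<close> 65) where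
  "G \<setminus> v = \<lparr>verts = verts G - {v}, edges = {e \<in> edges G. v \<notin> e}\<rparr>"

definition map_graph :: "('v \<Rightarrow> 'w) \<Rightarrow> 'v ugraph \<Rightarrow> 'w ugraph" where
  "map_graph f G = \<lparr>verts = f ` verts G, edges = (`) f ` edges G\<rparr>"

definition graph_hom :: "'v ugraph \<Rightarrow> 'w ugraph \<Rightarrow> ('v \<Rightarrow> 'w) \<Rightarrow> bool" where
  "graph_hom H G \<phi> \<longleftrightarrow>
     (\<forall>u\<in>verts H. \<phi> u \<in> verts G) \<and> (\<forall>u w. {u, w} \<in> edges H \<longrightarrow> {\<phi> u, \<phi> w} \<in> edges G)"

definition connected_graph :: "'v ugraph \<Rightarrow> bool" where
  "connected_graph G \<longleftrightarrow> verts G \<noteq> {} \<and>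
     (\<forall>u\<in>verts G. \<forall>w\<in>verts G. (u, w) \<in> {(a, b). {a, b} \<in> edges G}\<^sup>*)"

definition is_cycle :: "'v ugraph \<Rightarrow> 'v list \<Rightarrow> bool" where
  "is_cycle G c \<longleftrightarrow> 3 \<le> length c \<and> distinct c \<and>
     (\<forall>i<length c. {c ! i, c ! (Suc i mod length c)} \<in> edges G)"

definition is_tree :: "'v ugraph \<Rightarrow> bool" where
  "is_tree G \<longleftrightarrow> connected_graph G \<and> (\<nexists>c. is_cycle G c)"


section \<open>Vertex matching polynomials\<close>

definition matching :: "'v ugraph \<Rightarrow> 'v set set \<Rightarrow> bool" where
  "matching G M \<longleftrightarrow> M \<subseteq> edges G \<and> (\<forall>e\<in>M. \<forall>f\<in>M. e \<noteq> f \<longrightarrow> e \<inter> f = {})"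

definition vertex_matching_poly :: "'v ugraph \<Rightarrow> ('v, 'c::comm_ring_1) mpoly" where
  "vertex_matching_poly G = (\<Sum>M | matching G M. \<Prod>e\<in>M. - (\<Prod>u\<in>e. Var u))"

text \<open>
  The inner product runs over the two endpoints of \<open>e\<close>, so the two factors are both present even
  where \<open>\<phi>\<close> is not injective.
\<close>

definition rel_vertex_matching_poly ::
    "('w \<Rightarrow> 'v) \<Rightarrow> 'w ugraph \<Rightarrow> ('v, 'c::comm_ring_1) mpoly" where
  "rel_vertex_matching_poly \<phi> H = (\<Sum>M | matching H M. \<Prod>e\<in>M. - (\<Prod>u\<in>e. Var (\<phi> u)))"


section \<open>The path tree\<close>

text \<open>
  Vertices of path trees.  \<^term>\<open>Node u\<close> is a vertex labelled \<open>u\<close>, and \<^term>\<open>Branch w x\<close> is the copy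
  of the vertex \<open>x\<close> in the branch belonging to the neighbour \<open>w\<close>; the tag \<open>w\<close> makes the union of
  the branches disjoint.  In every path tree with respect to \<open>v\<close> the root is \<^term>\<open>Node v\<close>, and
  copying a vertex does not change its label.
\<close>

datatype 'v tree_vertex = Node 'v | Branch 'v "'v tree_vertex"

primrec tree_label :: "'v tree_vertex \<Rightarrow> 'v" where
  "tree_label (Node u) = u"
| "tree_label (Branch w x) = tree_label x"

abbreviation tree_root :: "'v \<Rightarrow> 'v tree_vertex" where
  "tree_root \<equiv> Node"

definition join_branches ::
    "'v \<Rightarrow> 'v set \<Rightarrow> ('v \<Rightarrow> 'v tree_vertex ugraph) \<Rightarrow> 'v tree_vertex ugraph" where
  "join_branches v W S = \<lparr>
     verts = {tree_root v} \<union> (\<Union>w\<in>W. verts (map_graph (Branch w) (S w))),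
     edges = {{tree_root v, Branch w (tree_root w)} | w. w \<in> W} \<union>
             (\<Union>w\<in>W. edges (map_graph (Branch w) (S w)))\<rparr>"

lemma join_branches_cong [fundef_cong]:
  "v = v' \<Longrightarrow> W = W' \<Longrightarrow> (\<And>w. w \<in> W' \<Longrightarrow> S w = S' w) \<Longrightarrow>
    join_branches v W S = join_branches v' W' S'"
  by (simp add: join_branches_def)

text \<open>The last case only makes the function total; it is void for a vertex of a finite graph.\<close>

function path_tree :: "'v ugraph \<Rightarrow> 'v \<Rightarrow> 'v tree_vertex ugraph" where
  "path_tree G v =
     (if is_tree G then map_graph Node G
      else if finite (verts G) \<and> v \<in> verts G then
        join_branches v (neighbours G v) (\<lambda>w. path_tree (G \<setminus> v) w)
      else \<lparr>verts = {}, edges = {}\<rparr>)"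
  by auto
termination
  by (relation "measure (\<lambda>(G, v). card (verts G))")
     (simp_all add: del_vertex_def card_Diff1_less del: card_Diff_insert card_Diff_singleton)

declare path_tree.simps [simp del]


section \<open>Well-definedness\<close>

lemma simple_graph_del_vertex: "simple_graph G \<Longrightarrow> simple_graph (G \<setminus> v)"
  by (auto simp: simple_graph_def del_vertex_def)

lemma neighbours_in_del_vertex:
  assumes "simple_graph G" "w \<in> neighbours G v"
  shows "w \<in> verts (G \<setminus> v)"
proof -
  have "{v, w} \<subseteq> verts G" "card {v, w} = 2"
    using assms by (auto simp: simple_graph_def neighbours_def)
  moreover have "w \<noteq> v" using \<open>card {v, w} = 2\<close> by auto
  ultimately show ?thesis by (simp add: del_vertex_def)
qed

lemma simple_graph_map_graph:
  assumes "simple_graph G" "inj f"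
  shows "simple_graph (map_graph f G)"
  using assms by (auto simp: simple_graph_def map_graph_def card_image inj_on_subset)

lemma path_tree_root: "v \<in> verts G \<Longrightarrow> finite (verts G) \<Longrightarrow> tree_root v \<in> verts (path_tree G v)"
  by (subst path_tree.simps) (auto simp: map_graph_def join_branches_def)

lemma simple_graph_path_tree:
  assumes "simple_graph G" "v \<in> verts G"
  shows "simple_graph (path_tree G v)"
  using assms
proof (induction G v rule: path_tree.induct)
  case (1 G v)
  show ?case
  proof (cases "is_tree G")
    case True
    thus ?thesis using 1(2)
      by (subst path_tree.simps) (simp add: simple_graph_map_graph inj_def)
  next
    case False
    have fin: "finite (verts G)" using 1(2) by (simp add: simple_graph_def)
    let ?S = "\<lambda>w. map_graph (Branch w) (path_tree (G \<setminus> v) w)"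
    have sub: "simple_graph (?S w)" "Branch w (tree_root w) \<in> verts (?S w)"
      if "w \<in> neighbours G v" for w
    proof -
      have w: "w \<in> verts (G \<setminus> v)" using 1(2) that by (rule neighbours_in_del_vertex)
      show "simple_graph (?S w)"
        using 1(1)[OF False _ that simple_graph_del_vertex[OF 1(2)] w] fin 1(3)
        by (intro simple_graph_map_graph) (auto simp: inj_def)
      show "Branch w (tree_root w) \<in> verts (?S w)"
        using path_tree_root[OF w] fin by (simp add: map_graph_def del_vertex_def)
    qed
    have "neighbours G v \<subseteq> verts G"
      using neighbours_in_del_vertex[OF 1(2)] by (auto simp: del_vertex_def)
    hence "finite (neighbours G v)" using fin finite_subset by blast
    moreover have "path_tree G v = join_branches v (neighbours G v) (path_tree (G \<setminus> v))"
      using False fin 1(3) by (subst path_tree.simps) simp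
    ultimately show ?thesis
      using sub by (fastforce simp: simple_graph_def join_branches_def)
  qed
qed

lemma graph_hom_tree_label:
  assumes "simple_graph G" "v \<in> verts G"
  shows "graph_hom (path_tree G v) G tree_label"
  using assms
proof (induction G v rule: path_tree.induct)
  case (1 G v)
  have fin: "finite (verts G)" using 1(2) by (simp add: simple_graph_def)
  show ?case
  proof (cases "is_tree G")
    case True
    hence "path_tree G v = map_graph Node G" by (simp add: path_tree.simps)
    moreover have "{tree_label a, tree_label b} = e" if "{a, b} = Node ` e" for a b :: "'a tree_vertex" and e
    proof -
      have "tree_label ` {a, b} = e" unfolding that by (simp add: image_image)
      thus ?thesis by simp
    qed
    ultimately show ?thesis by (auto simp: graph_hom_def map_graph_def)
  next
    case False
    have IH: "graph_hom (path_tree (G \<setminus> v) w) (G \<setminus> v) tree_label" if "w \<in> neighbours G v" for w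
      using 1(1)[OF False _ that simple_graph_del_vertex[OF 1(2)]]
        neighbours_in_del_vertex[OF 1(2) that] fin 1(3) by simp
    have pt: "path_tree G v = join_branches v (neighbours G v) (path_tree (G \<setminus> v))"
      using False fin 1(3) by (subst path_tree.simps) simp
    have "tree_label x \<in> verts G" if "x \<in> verts (path_tree G v)" for x
      using that IH 1(3) by (auto simp: pt join_branches_def map_graph_def graph_hom_def del_vertex_def)
    moreover have "tree_label ` d \<in> edges G" if d: "d \<in> edges (path_tree G v)" for d
    proof -
      consider w where "w \<in> neighbours G v" "d = {tree_root v, Branch w (tree_root w)}"
        | w e where "w \<in> neighbours G v" "e \<in> edges (path_tree (G \<setminus> v) w)" "d = Branch w ` e"
        using d by (auto simp: pt join_branches_def map_graph_def)
      thus ?thesis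
      proof cases
        case 1
        thus ?thesis by (simp add: neighbours_def)
      next
        case 2
        have "simple_graph (path_tree (G \<setminus> v) w)"
          using "1.prems"(1) 2(1)
          by (intro simple_graph_path_tree simple_graph_del_vertex neighbours_in_del_vertex)
        hence "card e = 2" using 2(2) by (auto simp: simple_graph_def)
        then obtain a b where e: "e = {a, b}" by (auto simp: card_2_iff)
        thus ?thesis using IH[OF 2(1)] 2 by (auto simp: graph_hom_def del_vertex_def)
      qed
    qed
    from this[of "{a, b}" for a b]
    have "{tree_label a, tree_label b} \<in> edges G" if "{a, b} \<in> edges (path_tree G v)" for a b
      using that by simp
    ultimately show ?thesis by (simp add: graph_hom_def)
  qed
qed

text \<open>Vertex matching polynomials have constant term 1, so they may be used as denominators.\<close>

lemma mcoeff_0_mult: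
  "mcoeff (p * q) (0 :: 'v \<Rightarrow>\<^sub>0 nat) = mcoeff p 0 * mcoeff q (0 :: 'v \<Rightarrow>\<^sub>0 nat)"
proof -
  have zero: "a = 0 \<and> b = 0" if "a + b = 0" for a b :: "'v \<Rightarrow>\<^sub>0 nat"
  proof -
    have "Poly_Mapping.lookup a u = 0 \<and> Poly_Mapping.lookup b u = 0" for u
      using arg_cong[OF that, of "\<lambda>m. Poly_Mapping.lookup m u"] by (simp add: lookup_add)
    thus ?thesis by (auto intro!: poly_mapping_eqI)
  qed
  have "Poly_Mapping.lookup (Rep_mpoly p * Rep_mpoly q) (0 + 0) =
      Poly_Mapping.lookup (Rep_mpoly p) 0 * Poly_Mapping.lookup (Rep_mpoly q) 0"
    by (rule lookup_times_unique, rule zero) (simp only: add_0_left)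
  thus ?thesis
    by (simp only: mcoeff_def times_mpoly.rep_eq add_0_left)
qed

lemma mcoeff_0_simps [simp]:
  "mcoeff (0 :: ('v, 'c::comm_ring_1) mpoly) m = 0"
  "mcoeff (1 :: ('v, 'c) mpoly) 0 = 1"
  "mcoeff (p + q) m = mcoeff p m + mcoeff (q :: ('v, 'c) mpoly) m"
  "mcoeff (- p) m = - mcoeff (p :: ('v, 'c) mpoly) m"
  by (simp_all add: mcoeff_def zero_mpoly.rep_eq one_mpoly.rep_eq plus_mpoly.rep_eq
        uminus_mpoly.rep_eq lookup_add lookup_one)

lemma mcoeff_0_Var [simp]: "mcoeff (Var u :: ('v, 'c::comm_ring_1) mpoly) 0 = 0"
proof -
  have "Poly_Mapping.single u (1::nat) \<noteq> 0"
    by (metis lookup_single_eq lookup_zero zero_neq_one)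
  thus ?thesis
    by (simp add: mcoeff_def Var.rep_eq lookup_single when_def)
qed

lemma rel_vertex_matching_poly_neq_0:
  assumes "simple_graph H"
  shows "(rel_vertex_matching_poly \<phi> H :: ('v, 'c::comm_ring_1) mpoly) \<noteq> 0"
proof -
  let ?t = "\<lambda>M. \<Prod>e\<in>M. - (\<Prod>u\<in>e. Var (\<phi> u)) :: ('v, 'c) mpoly"
  have finE: "finite (edges H)"
    using assms finite_subset[of "edges H" "Pow (verts H)"] by (auto simp: simple_graph_def)
  have finM: "finite {M. matching H M}"
    by (rule finite_subset[of _ "Pow (edges H)"]) (auto simp: matching_def finE)
  have prod0: "mcoeff (prod f A) 0 = (\<Prod>a\<in>A. mcoeff (f a) 0)"
    for f :: "'x \<Rightarrow> ('v, 'c) mpoly" and A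
    by (induction A rule: infinite_finite_induct) (auto simp: mcoeff_0_mult)
  have sum0: "mcoeff (sum f A) 0 = (\<Sum>a\<in>A. mcoeff (f a) 0)"
    for f :: "'x \<Rightarrow> ('v, 'c) mpoly" and A
    by (induction A rule: infinite_finite_induct) auto
  have "mcoeff (?t M) 0 = (if M = {} then 1 else 0)" if "matching H M" for M
  proof (cases "M = {}")
    case False
    then obtain e where e: "e \<in> M" by blast
    moreover have "finite M" using that finE by (auto simp: matching_def intro: finite_subset)
    moreover have "card e = 2" using e that assms by (auto simp: simple_graph_def matching_def)
    hence "mcoeff (- (\<Prod>u\<in>e. Var (\<phi> u)) :: ('v, 'c) mpoly) 0 = 0"
      by (auto simp: card_2_iff mcoeff_0_mult)
    ultimately have "mcoeff (?t M) 0 = 0"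
      unfolding prod0 by (intro prod_zero) blast+
    thus ?thesis using False by simp
  qed simp
  hence "mcoeff (rel_vertex_matching_poly \<phi> H :: ('v, 'c) mpoly) 0
      = (\<Sum>M | matching H M. if M = {} then 1 else 0)"
    unfolding rel_vertex_matching_poly_def sum0 by (intro sum.cong) auto
  also have "\<dots> = 1" using finM by (simp add: sum.delta matching_def)
  finally have "mcoeff (rel_vertex_matching_poly \<phi> H :: ('v, 'c) mpoly) 0 = 1" .
  thus ?thesis by auto
qed

lemma vertex_matching_poly_eq_rel: "vertex_matching_poly G = rel_vertex_matching_poly (\<lambda>u. u) G"
  by (simp add: vertex_matching_poly_def rel_vertex_matching_poly_def)

lemma vertex_matching_poly_neq_0:
  "simple_graph G \<Longrightarrow> (vertex_matching_poly G :: ('v, 'c::comm_ring_1) mpoly) \<noteq> 0"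
  by (simp add: vertex_matching_poly_eq_rel rel_vertex_matching_poly_neq_0)

end

theory Submission
  imports Defs
begin

text \<open>
  Expanding along the edges at \<open>v\<close> gives
  \<open>\<mu>(G) = \<mu>(G \<setminus> v) - (\<Sum>w. x\<^sub>v x\<^sub>w \<mu>(G \<setminus> v \<setminus> w))\<close>, summed over the neighbours \<open>w\<close> of \<open>v\<close>.  The same
  expansion at the root of \<open>T\<close> has factors \<open>\<mu>(T\<^sub>w)\<close> with \<open>T\<^sub>w = T\<^sub>w(G \<setminus> v)\<close>, since \<open>T \<setminus> v\<close> is the
  disjoint union of the \<open>T\<^sub>w\<close>; by induction
  \<open>\<mu>(G \<setminus> v) \<mu>(T\<^sub>w \<setminus> w) = \<mu>(T\<^sub>w) \<mu>(G \<setminus> v \<setminus> w)\<close>, so the two expansions are proportional.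

  For the divisibility, \<open>G\<close> has to be replaced by the component \<open>C\<close> of \<open>v\<close>, because \<open>G \<setminus> v\<close> may be
  disconnected.  Every component of \<open>C \<setminus> v\<close> contains a neighbour \<open>w\<close> of \<open>v\<close>, and its polynomial
  divides \<open>\<mu>(T\<^sub>w)\<close> by induction; hence \<open>\<mu>(C \<setminus> v)\<close> divides \<open>\<mu>(T \<setminus> v)\<close>, and the ratio identity
  transfers this to \<open>\<mu>(C)\<close> and \<open>\<mu>(T)\<close>.  All of this only concerns the edge sets of the graphs.
\<close>

section \<open>Matching polynomials of edge sets\<close>

text \<open>A simple graph without its vertex set: isolated vertices do not affect matchings, so
  deleting vertices and splitting into components become operations on sets of edges.\<close>

definition edge_set :: "'w set set \<Rightarrow> bool" where
  "edge_set E \<longleftrightarrow> finite E \<and> (\<forall>e\<in>E. card e = 2)"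

definition matchings :: "'w set set \<Rightarrow> 'w set set set" where
  "matchings E = {M. M \<subseteq> E \<and> (\<forall>e\<in>M. \<forall>f\<in>M. e \<noteq> f \<longrightarrow> e \<inter> f = {})}"

definition weight :: "('w \<Rightarrow> 'v) \<Rightarrow> 'w set set \<Rightarrow> ('v, 'c::comm_ring_1) mpoly" where
  "weight \<phi> M = (\<Prod>e\<in>M. - (\<Prod>u\<in>e. Var (\<phi> u)))"

definition match_poly :: "('w \<Rightarrow> 'v) \<Rightarrow> 'w set set \<Rightarrow> ('v, 'c::comm_ring_1) mpoly" where
  "match_poly \<phi> E = (\<Sum>M\<in>matchings E. weight \<phi> M)"

definition avoid :: "'w set set \<Rightarrow> 'w \<Rightarrow> 'w set set" where
  "avoid E v = {e \<in> E. v \<notin> e}"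

lemma rel_vertex_matching_poly_eq: "rel_vertex_matching_poly \<phi> H = match_poly \<phi> (edges H)"
  by (simp add: rel_vertex_matching_poly_def match_poly_def weight_def matchings_def matching_def)

lemma edges_del_vertex: "edges (G \<setminus> v) = avoid (edges G) v"
  by (simp add: del_vertex_def avoid_def)

lemma edge_set_edges: "simple_graph G \<Longrightarrow> edge_set (edges G)"
  using finite_subset[of "edges G" "Pow (verts G)"] by (auto simp: simple_graph_def edge_set_def)

lemma edge_set_subset: "edge_set E \<Longrightarrow> F \<subseteq> E \<Longrightarrow> edge_set F"
  by (auto simp: edge_set_def intro: finite_subset)

lemma avoid_subset: "avoid E v \<subseteq> E"
  by (auto simp: avoid_def)

lemma edge_set_avoid: "edge_set E \<Longrightarrow> edge_set (avoid E v)"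
  by (rule edge_set_subset[OF _ avoid_subset])

lemma edge_set_finite: "edge_set E \<Longrightarrow> finite E"
  by (simp add: edge_set_def)

lemma edge_set_neq: "edge_set E \<Longrightarrow> {v, w} \<in> E \<Longrightarrow> v \<noteq> w"
  by (fastforce simp: edge_set_def)

lemma edge_set_memE:
  assumes "edge_set E" "e \<in> E" "v \<in> e"
  obtains w where "e = {v, w}" "v \<noteq> w"
proof -
  have "card e = 2" using assms by (simp add: edge_set_def)
  then obtain a b where "e = {a, b}" "a \<noteq> b" by (auto simp: card_2_iff)
  thus ?thesis using that assms(3) by (metis insertE insert_commute singletonD)
qed

lemma edge_set_image:
  assumes "edge_set E" "inj f"
  shows "edge_set ((`) f ` E)"
  using assms by (auto simp: edge_set_def card_image inj_on_subset)

lemma matchingsD: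
  "M \<in> matchings E \<Longrightarrow> e \<in> M \<Longrightarrow> f \<in> M \<Longrightarrow> e \<noteq> f \<Longrightarrow> e \<inter> f = {}"
  unfolding matchings_def by blast

lemma finite_matchings: "finite E \<Longrightarrow> finite (matchings E)"
  by (rule finite_subset[of _ "Pow E"]) (auto simp: matchings_def)

lemma finite_matching: "finite E \<Longrightarrow> M \<in> matchings E \<Longrightarrow> finite M"
  by (auto simp: matchings_def intro: finite_subset)

lemma match_poly_neq_0:
  assumes "edge_set E"
  shows "(match_poly \<phi> E :: ('v, 'c::comm_ring_1) mpoly) \<noteq> 0"
proof -
  have "finite e" if "e \<in> E" for e
    using assms that by (intro card_ge_0_finite) (simp add: edge_set_def)
  \<comment> \<open>The covered vertices serve as vertex set, which makes the result for simple
    graphs applicable.\<close>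
  hence "simple_graph \<lparr>verts = \<Union>E, edges = E\<rparr>"
    using assms by (auto simp: simple_graph_def edge_set_def)
  from rel_vertex_matching_poly_neq_0[OF this] show ?thesis
    by (simp add: rel_vertex_matching_poly_eq)
qed

section \<open>Relabelling and disjoint unions\<close>

lemma match_poly_empty:
  fixes \<phi> :: "'w \<Rightarrow> 'v"
  shows "match_poly \<phi> {} = 1"
proof -
  have "matchings {} = {{} :: 'w set set}" by (auto simp: matchings_def)
  thus ?thesis by (simp add: match_poly_def weight_def)
qed

text \<open>An injection on vertices induces a bijection between matchings, and the labels are
  merely composed with it. This moves polynomials through the constructors \<open>Node\<close> and
  \<open>Branch w\<close>.\<close>

lemma match_poly_image:
  fixes f :: "'a \<Rightarrow> 'b" and \<phi> :: "'b \<Rightarrow> 'v"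
  assumes "inj f"
  shows "match_poly \<phi> ((`) f ` E) = (match_poly (\<phi> \<circ> f) E :: ('v, 'c::comm_ring_1) mpoly)"
proof -
  \<comment> \<open>Injectivity is lifted from vertices to edges and then to sets of edges; each
    level serves one reindexing, of the product over an edge, over a matching, and of the sum over
    matchings.\<close>
  have inj1: "inj ((`) f)" using assms by (simp add: inj_image_eq_iff inj_def)
  have inj2: "inj ((`) ((`) f))" using inj1 by (simp add: inj_image_eq_iff inj_def)
  have "matchings ((`) f ` E) = (`) ((`) f) ` matchings E"
  proof (intro set_eqI iffI)
    fix M assume M: "M \<in> matchings ((`) f ` E)"
    then obtain N where N: "N \<subseteq> E" "M = (`) f ` N"
      unfolding matchings_def by (auto simp: subset_image_iff)
    have "e \<inter> e' = {}" if "e \<in> N" "e' \<in> N" "e \<noteq> e'" for e e'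
    proof -
      have "f ` e \<noteq> f ` e'" using that assms by (simp add: inj_image_eq_iff)
      hence "f ` e \<inter> f ` e' = {}" using matchingsD[OF M] N that by blast
      thus ?thesis by auto
    qed
    hence "N \<in> matchings E" using N by (auto simp: matchings_def)
    thus "M \<in> (`) ((`) f) ` matchings E" using N by blast
  next
    fix M assume "M \<in> (`) ((`) f) ` matchings E"
    then obtain N where N: "N \<in> matchings E" "M = (`) f ` N" by blast
    have "f ` e \<inter> f ` e' = {}" if "e \<in> N" "e' \<in> N" "f ` e \<noteq> f ` e'" for e e'
    proof -
      have "e \<inter> e' = {}" using N(1) that matchingsD by metis
      thus ?thesis using assms by (metis image_Int image_empty)
    qed
    thus "M \<in> matchings ((`) f ` E)" using N by (auto simp: matchings_def)
  qed
  hence "match_poly \<phi> ((`) f ` E) = (\<Sum>M\<in>matchings E. weight \<phi> ((`) f ` M) :: ('v, 'c) mpoly)"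
    unfolding match_poly_def using inj2 by (simp add: sum.reindex inj_on_subset)
  also have "\<dots> = match_poly (\<phi> \<circ> f) E"
    unfolding match_poly_def
  proof (rule sum.cong[OF refl])
    fix M
    show "weight \<phi> ((`) f ` M) = (weight (\<phi> \<circ> f) M :: ('v, 'c) mpoly)"
      unfolding weight_def using inj1 assms
      by (simp add: prod.reindex inj_on_subset)
  qed
  finally show ?thesis .
qed

text \<open>A matching of the union is the same as a pair of matchings, one in each part, because
  edges from different parts share no vertex; weights multiply.\<close>

lemma match_poly_Un:
  fixes \<phi> :: "'w \<Rightarrow> 'v"
  assumes "edge_set E" "edge_set F" "\<Union>E \<inter> \<Union>F = {}"
  shows "match_poly \<phi> (E \<union> F) = (match_poly \<phi> E * match_poly \<phi> F :: ('v, 'c::comm_ring_1) mpoly)"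
proof -
  \<comment> \<open>A common edge would be nonempty and hence give a common vertex. Disjointness
    lets the two halves of a matching be recovered by intersecting with \<open>E\<close> and
    \<open>F\<close>.\<close>
  have EF: "E \<inter> F = {}"
  proof -
    have "e \<noteq> {}" if "e \<in> E" for e using assms(1) that by (auto simp: edge_set_def)
    thus ?thesis using assms(3) by fast
  qed
  let ?u = "\<lambda>(M, N). M \<union> N"
  have inj: "inj_on ?u (matchings E \<times> matchings F)"
  proof (rule inj_onI, clarify)
    fix M N M' N'
    assume "M \<in> matchings E" "N \<in> matchings F" "M' \<in> matchings E" "N' \<in> matchings F"
      and eq: "M \<union> N = M' \<union> N'"
    hence "M = (M \<union> N) \<inter> E" "N = (M \<union> N) \<inter> F" "M' = (M' \<union> N') \<inter> E" "N' = (M' \<union> N') \<inter> F"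
      using EF by (auto simp: matchings_def)
    thus "M = M' \<and> N = N'" using eq by metis
  qed
  have img: "matchings (E \<union> F) = ?u ` (matchings E \<times> matchings F)"
  proof (intro set_eqI iffI)
    fix M assume M: "M \<in> matchings (E \<union> F)"
    hence "M = (M \<inter> E) \<union> (M \<inter> F)" by (auto simp: matchings_def)
    moreover have "M \<inter> E \<in> matchings E" "M \<inter> F \<in> matchings F" using M by (auto simp: matchings_def)
    ultimately show "M \<in> ?u ` (matchings E \<times> matchings F)"
      by (intro image_eqI[of _ _ "(M \<inter> E, M \<inter> F)"]) simp_all
  next
    fix X assume "X \<in> ?u ` (matchings E \<times> matchings F)"
    then obtain M N where X: "X = M \<union> N" and M: "M \<in> matchings E" and N: "N \<in> matchings F" by auto
    have "e \<inter> f = {}" if "e \<in> M" "f \<in> N" for e f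
    proof -
      have "e \<in> E" "f \<in> F" using that M N by (auto simp: matchings_def)
      thus ?thesis using assms(3) by blast
    qed
    hence "e \<inter> f = {}" if "e \<in> X" "f \<in> X" "e \<noteq> f" for e f
      using that matchingsD[OF M] matchingsD[OF N] unfolding X by (metis Int_commute UnE)
    thus "X \<in> matchings (E \<union> F)" using M N by (auto simp: X matchings_def)
  qed
  have w: "weight \<phi> (M \<union> N) = (weight \<phi> M * weight \<phi> N :: ('v, 'c) mpoly)"
    if "M \<in> matchings E" "N \<in> matchings F" for M N
  proof -
    have "M \<inter> N = {}" using that EF by (auto simp: matchings_def)
    moreover have "finite M" "finite N" using that assms(1,2) edge_set_finite finite_matching by blast+
    ultimately show ?thesis by (simp add: weight_def prod.union_disjoint)
  qed
  have "match_poly \<phi> (E \<union> F) = (\<Sum>(M, N)\<in>matchings E \<times> matchings F. weight \<phi> (M \<union> N) :: ('v, 'c) mpoly)"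
    unfolding match_poly_def img sum.reindex[OF inj] by (simp add: case_prod_unfold)
  also have "\<dots> = (\<Sum>(M, N)\<in>matchings E \<times> matchings F. weight \<phi> M * weight \<phi> N)"
    by (intro sum.cong) (auto simp: w)
  also have "\<dots> = match_poly \<phi> E * match_poly \<phi> F"
    by (simp add: match_poly_def sum_product sum.cartesian_product)
  finally show ?thesis .
qed

lemma match_poly_UN:
  fixes \<phi> :: "'w \<Rightarrow> 'v"
  assumes "finite I" "\<And>i. i \<in> I \<Longrightarrow> edge_set (F i)"
    and "\<And>i j. i \<in> I \<Longrightarrow> j \<in> I \<Longrightarrow> i \<noteq> j \<Longrightarrow> \<Union>(F i) \<inter> \<Union>(F j) = {}"
  shows "match_poly \<phi> (\<Union>i\<in>I. F i) = (\<Prod>i\<in>I. match_poly \<phi> (F i) :: ('v, 'c::comm_ring_1) mpoly)"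
  using assms
proof (induction I rule: finite_induct)
  case empty
  thus ?case by (simp add: match_poly_empty)
next
  case (insert i I)
  have "match_poly \<phi> (F i \<union> (\<Union>j\<in>I. F j)) = (match_poly \<phi> (F i) * match_poly \<phi> (\<Union>j\<in>I. F j) :: ('v, 'c) mpoly)"
  proof (rule match_poly_Un)
    show "edge_set (\<Union>j\<in>I. F j)" using insert.hyps insert.prems(1) by (auto simp: edge_set_def)
    have "\<Union>(F i) \<inter> \<Union>(F j) = {}" if "j \<in> I" for j
      using insert.prems(2)[of i j] insert.hyps that by blast
    thus "\<Union>(F i) \<inter> \<Union>(\<Union>j\<in>I. F j) = {}" by blast
  qed (simp add: insert.prems)
  thus ?case using insert by simp
qed

section \<open>Expansion at a vertex\<close>

lemma finite_nbrs:
  assumes "edge_set E"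
  shows "finite {w. {v, w} \<in> E}"
proof (rule finite_subset)
  have "finite e" if "e \<in> E" for e
    using assms that by (intro card_ge_0_finite) (simp add: edge_set_def)
  thus "finite (\<Union>E)" using assms by (simp add: edge_set_def)
qed auto

text \<open>A matching either misses \<open>v\<close> or contains exactly one edge
  \<open>{v, w}\<close> at \<open>v\<close>; removing that edge leaves a matching that avoids both
  ends.\<close>

lemma match_poly_expand:
  fixes \<phi> :: "'w \<Rightarrow> 'v"
  assumes E: "edge_set E"
  shows "match_poly \<phi> E = match_poly \<phi> (avoid E v)
    - (\<Sum>w | {v, w} \<in> E. Var (\<phi> v) * Var (\<phi> w) * (match_poly \<phi> (avoid (avoid E v) w) :: ('v, 'c::comm_ring_1) mpoly))"
proof -
  let ?N = "{w. {v, w} \<in> E}"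
  let ?A = "\<lambda>w. avoid (avoid E v) w"
  let ?B = "\<lambda>w. insert {v, w} ` matchings (?A w)"
  have fin: "finite (avoid E v)" "finite (?A w)" for w
    using E by (simp_all add: edge_set_avoid edge_set_finite)
  have out: "{v, w} \<notin> M" if "M \<in> matchings (avoid E v)" for M w
    using that by (auto simp: matchings_def avoid_def)
  have sub: "matchings (?A w) \<subseteq> matchings (avoid E v)" for w
    by (auto simp: matchings_def avoid_def)
  have split: "matchings E = matchings (avoid E v) \<union> (\<Union>w\<in>?N. ?B w)"
  proof (intro set_eqI iffI)
    fix M assume M: "M \<in> matchings E"
    show "M \<in> matchings (avoid E v) \<union> (\<Union>w\<in>?N. ?B w)"
    proof (cases "\<exists>e\<in>M. v \<in> e")
      case False
      thus ?thesis using M by (auto simp: matchings_def avoid_def)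
    next
      case True
      then obtain e where e: "e \<in> M" "v \<in> e" by blast
      moreover have "e \<in> E" using M e by (auto simp: matchings_def)
      ultimately obtain w where w: "e = {v, w}" by (metis E edge_set_memE)
      have "v \<notin> f \<and> w \<notin> f \<and> f \<in> E" if "f \<in> M - {e}" for f
      proof -
        have "e \<inter> f = {}" using matchingsD[OF M e(1)] that by blast
        moreover have "f \<in> E" using M that by (auto simp: matchings_def)
        ultimately show ?thesis using w by blast
      qed
      hence "M - {e} \<in> matchings (?A w)"
        using M by (auto simp: matchings_def avoid_def)
      moreover have "M = insert {v, w} (M - {e})" using e w by blast
      ultimately show ?thesis using \<open>e \<in> E\<close> w by blast
    qed
  next
    fix M assume "M \<in> matchings (avoid E v) \<union> (\<Union>w\<in>?N. ?B w)"
    then consider "M \<in> matchings (avoid E v)"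
      | w N where "{v, w} \<in> E" "N \<in> matchings (?A w)" "M = insert {v, w} N" by blast
    thus "M \<in> matchings E"
    proof cases
      case 1
      thus ?thesis by (auto simp: matchings_def avoid_def)
    next
      case 2
      hence "{v, w} \<inter> f = {}" if "f \<in> N" for f
        using that by (auto simp: matchings_def avoid_def)
      thus ?thesis using 2 unfolding matchings_def avoid_def by (auto simp: Int_commute)
    qed
  qed
  have wt: "sum (weight \<phi>) (?B w) = - (Var (\<phi> v) * Var (\<phi> w) * (match_poly \<phi> (?A w) :: ('v, 'c) mpoly))"
    if w: "w \<in> ?N" for w
  proof -
    have "v \<noteq> w" using E w edge_set_neq by fastforce
    have "inj_on (insert {v, w}) (matchings (?A w))"
    proof (rule inj_onI)
      fix M N assume "M \<in> matchings (?A w)" "N \<in> matchings (?A w)"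
        and eq: "insert {v, w} M = insert {v, w} N"
      hence "{v, w} \<notin> M" "{v, w} \<notin> N" using out sub by blast+
      thus "M = N" using eq by (metis insert_ident)
    qed
    hence "sum (weight \<phi>) (?B w) = (\<Sum>M\<in>matchings (?A w). weight \<phi> (insert {v, w} M) :: ('v, 'c) mpoly)"
      by (simp add: sum.reindex)
    also have "\<dots> = (\<Sum>M\<in>matchings (?A w). - (Var (\<phi> v) * Var (\<phi> w)) * weight \<phi> M)"
    proof (rule sum.cong[OF refl])
      fix M assume M: "M \<in> matchings (?A w)"
      hence "{v, w} \<notin> M" "finite M" using out sub fin finite_matching by blast+
      thus "weight \<phi> (insert {v, w} M) = - (Var (\<phi> v) * Var (\<phi> w)) * (weight \<phi> M :: ('v, 'c) mpoly)"
        using \<open>v \<noteq> w\<close> by (simp add: weight_def)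
    qed
    finally show ?thesis by (simp add: match_poly_def sum_distrib_left[symmetric] sum_negf)
  qed
  have finB: "finite (?B w)" for w using fin finite_matchings by blast
  \<comment> \<open>The partner \<open>w\<close> can be read off from the matching, since
    \<open>{v, w}\<close> is its only edge at \<open>v\<close>.\<close>
  have disjB: "?B w \<inter> ?B w' = {}" if "w \<noteq> w'" for w w'
  proof -
    have False if "insert {v, w} M = insert {v, w'} M'" "M' \<in> matchings (?A w')" for M M'
    proof -
      have "{v, w} \<notin> M'" using out sub that(2) by blast
      hence "{v, w} = {v, w'}" using that(1) by blast
      thus False using \<open>w \<noteq> w'\<close> by (simp add: doubleton_eq_iff)
    qed
    thus ?thesis by blast
  qed
  have "match_poly \<phi> E = sum (weight \<phi>) (matchings (avoid E v)) + (sum (weight \<phi>) (\<Union>w\<in>?N. ?B w) :: ('v, 'c) mpoly)"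
    unfolding match_poly_def split
  proof (rule sum.union_disjoint)
    show "finite (matchings (avoid E v))" using fin(1) by (rule finite_matchings)
    show "finite (\<Union>w\<in>?N. ?B w)" using finB finite_nbrs[OF E] by blast
    show "matchings (avoid E v) \<inter> (\<Union>w\<in>?N. ?B w) = {}" using out by auto
  qed
  also have "sum (weight \<phi>) (\<Union>w\<in>?N. ?B w) = (\<Sum>w\<in>?N. sum (weight \<phi>) (?B w) :: ('v, 'c) mpoly)"
    using finite_nbrs[OF E] by (rule sum.UNION_disjoint) (simp_all add: finB disjB)
  also have "\<dots> = (\<Sum>w\<in>?N. - (Var (\<phi> v) * Var (\<phi> w) * match_poly \<phi> (?A w)))"
    by (intro sum.cong wt refl)
  finally show ?thesis by (simp add: match_poly_def[of _ "avoid E v"] sum_negf)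
qed

section \<open>Components\<close>

text \<open>The vertex set of the connected component of \<open>v\<close>; it contains
  \<open>v\<close> even when no edge does, and \<open>component E v\<close> is then empty.\<close>

definition reach :: "'w set set \<Rightarrow> 'w \<Rightarrow> 'w set" where
  "reach E v = {(a, b). {a, b} \<in> E}\<^sup>* `` {v}"

definition component :: "'w set set \<Rightarrow> 'w \<Rightarrow> 'w set set" where
  "component E v = {e \<in> E. e \<inter> reach E v \<noteq> {}}"

lemma component_subset: "component E v \<subseteq> E"
  by (auto simp: component_def)

lemma reach_refl: "v \<in> reach E v"
  by (simp add: reach_def)

lemma reach_step: "u \<in> reach E v \<Longrightarrow> {u, w} \<in> E \<Longrightarrow> w \<in> reach E v"
  by (auto simp: reach_def intro: rtrancl_into_rtrancl)

lemma reach_eq: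
  assumes "u \<in> reach E v"
  shows "reach E u = reach E v"
proof -
  let ?R = "{(a, b). {a, b} \<in> E}"
  have "sym ?R" by (auto simp: sym_def insert_commute)
  hence "(u, v) \<in> ?R\<^sup>*" "(v, u) \<in> ?R\<^sup>*"
    using assms sym_rtrancl[of ?R] by (auto simp: reach_def dest: symD)
  thus ?thesis by (auto simp: reach_def intro: rtrancl_trans)
qed

lemma component_closed:
  assumes "edge_set E" "e \<in> component E v"
  shows "e \<subseteq> reach E v"
proof
  fix x assume "x \<in> e"
  obtain u where u: "u \<in> e" "u \<in> reach E v" using assms(2) by (auto simp: component_def)
  have "e \<in> E" using assms(2) by (simp add: component_def)
  then obtain w where "e = {u, w}" using edge_set_memE assms(1) u(1) by metis
  thus "x \<in> reach E v" using \<open>x \<in> e\<close> \<open>e \<in> E\<close> u(2) reach_step by fast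
qed

text \<open>Components that share a vertex have the same \<open>reach\<close>. The assumption
  compares components rather than vertices, since different vertices may span the same one.\<close>

lemma component_disjoint:
  assumes "edge_set E" "component E v \<noteq> component E w"
  shows "\<Union>(component E v) \<inter> \<Union>(component E w) = {}"
proof (rule ccontr)
  assume "\<Union>(component E v) \<inter> \<Union>(component E w) \<noteq> {}"
  then obtain x where "x \<in> reach E v" "x \<in> reach E w"
    using component_closed[OF assms(1)] by blast
  hence "reach E v = reach E w" using reach_eq by metis
  thus False using assms(2) by (simp add: component_def)
qed

lemma component_rest_disjoint:
  assumes "edge_set E"
  shows "\<Union>(component E v) \<inter> \<Union>(E - component E v) = {}"
  using component_closed[OF assms, of _ v] by (fastforce simp: component_def)

text \<open>Cut a walk from \<open>v\<close> to \<open>u\<close> at its last visit to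
  \<open>v\<close>: the next vertex is a neighbour \<open>w\<close>, and the rest of the walk avoids
  \<open>v\<close>. In the induction, a step that leaves \<open>v\<close> starts afresh with a new
  \<open>w\<close>.\<close>

lemma reach_avoid:
  assumes "u \<in> reach E v"
  shows "u = v \<or> (\<exists>w. {v, w} \<in> E \<and> u \<in> reach (avoid E v) w)"
proof -
  have "(v, u) \<in> {(a, b). {a, b} \<in> E}\<^sup>*" using assms by (simp add: reach_def)
  thus ?thesis
  proof (induction rule: rtrancl_induct)
    case base
    show ?case by simp
  next
    case (step u u')
    show ?case
    proof (cases "u = v \<or> u' = v")
      case True
      thus ?thesis using step.hyps(2) reach_refl by fast
    next
      case False
      then obtain w where w: "{v, w} \<in> E" "u \<in> reach (avoid E v) w" using step.IH by blast
      have "{u, u'} \<in> avoid E v" using False step.hyps(2) by (auto simp: avoid_def)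
      thus ?thesis using w reach_step by fast
    qed
  qed
qed

text \<open>Deleting \<open>v\<close> breaks its component into pieces, each of which contains a
  neighbour of \<open>v\<close> by \<open>reach_avoid\<close>. Repetitions in the union are
  possible, as neighbours may lie in the same piece.\<close>

lemma avoid_component:
  "avoid (component E v) v = (\<Union>w\<in>{w. {v, w} \<in> E}. component (avoid E v) w)"
proof (intro set_eqI iffI)
  fix e assume "e \<in> avoid (component E v) v"
  then obtain u where e: "e \<in> avoid E v" "u \<in> e" "u \<in> reach E v" "u \<noteq> v"
    by (auto simp: avoid_def component_def)
  then obtain w where "{v, w} \<in> E" "u \<in> reach (avoid E v) w" using reach_avoid by fast
  thus "e \<in> (\<Union>w\<in>{w. {v, w} \<in> E}. component (avoid E v) w)" using e by (auto simp: component_def)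
next
  fix e assume "e \<in> (\<Union>w\<in>{w. {v, w} \<in> E}. component (avoid E v) w)"
  then obtain w u where w: "{v, w} \<in> E" and e: "e \<in> avoid E v" "u \<in> e" "u \<in> reach (avoid E v) w"
    by (auto simp: component_def)
  have "{(a, b). {a, b} \<in> avoid E v} \<subseteq> {(a, b). {a, b} \<in> E}" by (auto simp: avoid_def)
  hence "reach (avoid E v) w \<subseteq> reach E w"
    unfolding reach_def using rtrancl_mono by blast
  moreover have "reach E w = reach E v"
    using reach_eq reach_step[OF reach_refl w] by fast
  ultimately have "u \<in> reach E v" using e by blast
  thus "e \<in> avoid (component E v) v" using e by (auto simp: avoid_def component_def)
qed

text \<open>Specializes divisibility by the component of \<open>v\<close> to connected graphs, and
  in particular settles the case of a tree.\<close>

lemma component_connected_graph: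
  assumes "simple_graph G" "connected_graph G" "v \<in> verts G"
  shows "component (edges G) v = edges G"
proof
  show "edges G \<subseteq> component (edges G) v"
  proof
    fix e assume e: "e \<in> edges G"
    hence "card e = 2" "e \<subseteq> verts G" using assms(1) by (auto simp: simple_graph_def)
    then obtain a where a: "a \<in> e" "a \<in> verts G" by (auto simp: card_2_iff)
    hence "a \<in> reach (edges G) v" using assms(2,3) by (simp add: connected_graph_def reach_def)
    thus "e \<in> component (edges G) v" using a e by (auto simp: component_def)
  qed
qed (rule component_subset)

text \<open>The left side has one factor per component, the right side one per neighbour of
  \<open>v\<close>. Grouping the neighbours by component, a single member of each group already
  supplies the factor required.\<close>

lemma match_poly_component_avoid_dvd:
  fixes \<phi> :: "'w \<Rightarrow> 'v" and t :: "'w \<Rightarrow> ('v, 'c::comm_ring_1) mpoly"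
  assumes E: "edge_set E"
    and dvd: "\<And>w. {v, w} \<in> E \<Longrightarrow> match_poly \<phi> (component (avoid E v) w) dvd t w"
  shows "match_poly \<phi> (avoid (component E v) v) dvd (\<Prod>w | {v, w} \<in> E. t w)"
proof -
  let ?N = "{w. {v, w} \<in> E}"
  let ?C = "component (avoid E v)"
  have E': "edge_set (avoid E v)" using E by (rule edge_set_avoid)
  have N: "finite ?N" using E by (rule finite_nbrs)
  have "match_poly \<phi> (avoid (component E v) v) = match_poly \<phi> (\<Union>c\<in>?C ` ?N. c)"
    by (simp add: avoid_component)
  also have "\<dots> = (\<Prod>c\<in>?C ` ?N. match_poly \<phi> c)"
    using N component_disjoint[OF E']
    by (intro match_poly_UN) (auto intro: edge_set_subset[OF E' component_subset])
  also have "\<dots> dvd (\<Prod>c\<in>?C ` ?N. \<Prod>w\<in>{w\<in>?N. ?C w = c}. t w)"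
  proof (rule prod_dvd_prod)
    fix c assume "c \<in> ?C ` ?N"
    then obtain w where w: "w \<in> ?N" "c = ?C w" by blast
    hence "match_poly \<phi> c dvd t w" using dvd by blast
    also have "t w dvd (\<Prod>w\<in>{w\<in>?N. ?C w = c}. t w)" using w N by (intro dvd_prodI) auto
    finally show "match_poly \<phi> c dvd (\<Prod>w\<in>{w\<in>?N. ?C w = c}. t w)" .
  qed
  also have "(\<Prod>c\<in>?C ` ?N. \<Prod>w\<in>{w\<in>?N. ?C w = c}. t w) = (\<Prod>w\<in>?N. t w)"
    using N by (rule prod.image_gen[symmetric])
  finally show ?thesis .
qed

section \<open>The path tree\<close>

lemma edges_join_branches_avoid_root:
  "avoid (edges (join_branches v W S)) (Node v) = (\<Union>w\<in>W. (`) (Branch w) ` edges (S w))"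
  by (auto simp: avoid_def join_branches_def map_graph_def)

lemma join_branches_root_nbrs:
  "{x. {Node v, x} \<in> edges (join_branches v W S)} = (\<lambda>w. Branch w (Node w)) ` W"
proof -
  \<comment> \<open>Edges inside a branch have only \<open>Branch\<close> vertices, so only the
    joining edges meet the root.\<close>
  have no: "{Node v, x} \<notin> (`) (Branch w) ` E" for x w E
  proof
    assume "{Node v, x} \<in> (`) (Branch w) ` E"
    then obtain e where "{Node v, x} = Branch w ` e" by blast
    hence "Node v \<in> Branch w ` e" by blast
    thus False by blast
  qed
  have root: "{Node v, x} = {Node v, Branch w (Node w)} \<longleftrightarrow> x = Branch w (Node w)" for x w
    by (auto simp: doubleton_eq_iff)
  have "{Node v, x} \<in> edges (join_branches v W S) \<longleftrightarrow> (\<exists>w. x = Branch w (Node w) \<and> w \<in> W)" for x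
    by (simp add: join_branches_def map_graph_def no root)
  thus ?thesis by auto
qed

lemma branches_disjoint:
  "w \<noteq> w' \<Longrightarrow> \<Union>((`) (Branch w) ` E) \<inter> \<Union>((`) (Branch w') ` F) = {}"
  by auto

lemma match_poly_branch:
  "match_poly tree_label ((`) (Branch w) ` E) = match_poly tree_label E"
proof -
  have "inj (Branch w)" "tree_label \<circ> Branch w = tree_label" by (auto simp: inj_def)
  thus ?thesis by (simp add: match_poly_image)
qed

text \<open>Different tags make the copies disjoint, so the polynomial factors. The edge sets are
  arbitrary because one branch may have lost its root.\<close>

lemma match_poly_branches:
  fixes F :: "'v \<Rightarrow> 'v tree_vertex set set"
  assumes "finite W" "\<And>w. w \<in> W \<Longrightarrow> edge_set (F w)"
  shows "match_poly tree_label (\<Union>w\<in>W. (`) (Branch w) ` F w) =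
    (\<Prod>w\<in>W. match_poly tree_label (F w) :: ('v, 'c::comm_ring_1) mpoly)"
proof -
  have inj: "inj (Branch w)" for w :: 'v by (auto simp: inj_def)
  have "match_poly tree_label (\<Union>w\<in>W. (`) (Branch w) ` F w) =
      (\<Prod>w\<in>W. match_poly tree_label ((`) (Branch w) ` F w) :: ('v, 'c) mpoly)"
  proof (rule match_poly_UN)
    show "edge_set ((`) (Branch w) ` F w)" if "w \<in> W" for w
      using assms(2)[OF that] inj by (rule edge_set_image)
  qed (use assms(1) branches_disjoint in blast)+
  thus ?thesis by (simp only: match_poly_branch)
qed

text \<open>Expansion at the root: without it the branches fall apart, and deleting in addition the
  root of branch \<open>w\<close> changes only the factor of that branch.\<close>

lemma match_poly_join_branches:
  fixes S :: "'v \<Rightarrow> 'v tree_vertex ugraph"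
  assumes W: "finite W" and S: "\<And>w. w \<in> W \<Longrightarrow> edge_set (edges (S w))"
    and J: "edge_set (edges (join_branches v W S))"
  shows "match_poly tree_label (edges (join_branches v W S)) =
    (\<Prod>w\<in>W. match_poly tree_label (edges (S w))) -
    (\<Sum>w\<in>W. Var v * Var w * (match_poly tree_label (avoid (edges (S w)) (Node w)) *
      (\<Prod>x\<in>W - {w}. match_poly tree_label (edges (S x))) :: ('v, 'c::comm_ring_1) mpoly))"
proof -
  let ?m = "\<lambda>E. match_poly tree_label E :: ('v, 'c) mpoly"
  let ?J = "edges (join_branches v W S)"
  let ?b = "\<lambda>w. Branch w (Node w)"
  have J0: "?m (avoid ?J (Node v)) = (\<Prod>w\<in>W. ?m (edges (S w)))"
    unfolding edges_join_branches_avoid_root using W S by (rule match_poly_branches)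
  have J1: "?m (avoid (avoid ?J (Node v)) (?b w)) =
      ?m (avoid (edges (S w)) (Node w)) * (\<Prod>x\<in>W - {w}. ?m (edges (S x)))"
    if w: "w \<in> W" for w
  proof -
    let ?F = "\<lambda>x. if x = w then avoid (edges (S w)) (Node w) else edges (S x)"
    have "avoid (avoid ?J (Node v)) (?b w) = (\<Union>x\<in>W. (`) (Branch x) ` ?F x)"
      unfolding edges_join_branches_avoid_root using w
      by (fastforce simp: avoid_def split: if_splits)
    hence "?m (avoid (avoid ?J (Node v)) (?b w)) = (\<Prod>x\<in>W. ?m (?F x))"
      using W S by (simp only:) (intro match_poly_branches, auto simp: edge_set_avoid)
    also have "\<dots> = ?m (?F w) * (\<Prod>x\<in>W - {w}. ?m (?F x))"
      using W w by (rule prod.remove)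
    also have "(\<Prod>x\<in>W - {w}. ?m (?F x)) = (\<Prod>x\<in>W - {w}. ?m (edges (S x)))"
      by (intro prod.cong) auto
    finally show ?thesis by simp
  qed
  have inj: "inj_on ?b W" by (auto simp: inj_on_def)
  show ?thesis
    unfolding match_poly_expand[OF J, of tree_label "Node v"] J0 join_branches_root_nbrs
      sum.reindex[OF inj]
    by (simp add: J1)
qed

lemma path_tree_not_tree:
  "simple_graph G \<Longrightarrow> v \<in> verts G \<Longrightarrow> \<not> is_tree G \<Longrightarrow>
    path_tree G v = join_branches v (neighbours G v) (path_tree (G \<setminus> v))"
  by (subst path_tree.simps) (simp add: simple_graph_def)

text \<open>The recursion of \<open>path_tree\<close> restricted to its meaningful cases:
  \<open>G \<setminus> v\<close> is again simple and contains the neighbours of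
  \<open>v\<close>.\<close>

lemma path_tree_induct [consumes 2, case_names tree branch]:
  assumes "simple_graph G" "v \<in> verts G"
    and "\<And>G v. simple_graph G \<Longrightarrow> v \<in> verts G \<Longrightarrow> is_tree G \<Longrightarrow> P G v"
    and "\<And>G v. simple_graph G \<Longrightarrow> v \<in> verts G \<Longrightarrow> \<not> is_tree G \<Longrightarrow>
      (\<And>w. w \<in> neighbours G v \<Longrightarrow> P (G \<setminus> v) w) \<Longrightarrow> P G v"
  shows "P G v"
  using assms(1,2)
proof (induction G v rule: path_tree.induct)
  case (1 G v)
  show ?case
  proof (cases "is_tree G")
    case True
    show ?thesis using "1.prems" True by (rule assms(3))
  next
    case False
    have "P (G \<setminus> v) w" if "w \<in> neighbours G v" for w
      using 1(1)[OF False _ that] "1.prems" simple_graph_del_vertex[OF "1.prems"(1)]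
        neighbours_in_del_vertex[OF "1.prems"(1) that]
      by (simp add: simple_graph_def)
    with "1.prems" False show ?thesis by (rule assms(4))
  qed
qed

section \<open>Ratio identity and divisibility\<close>

lemma edge_set_path_tree: "simple_graph G \<Longrightarrow> v \<in> verts G \<Longrightarrow> edge_set (edges (path_tree G v))"
  by (intro edge_set_edges simple_graph_path_tree)

lemma edge_set_path_tree_nbr:
  "simple_graph G \<Longrightarrow> w \<in> neighbours G v \<Longrightarrow> edge_set (edges (path_tree (G \<setminus> v) w))"
  by (intro edge_set_path_tree simple_graph_del_vertex neighbours_in_del_vertex)

text \<open>Here the path tree is a copy of \<open>G\<close> under \<open>Node\<close>, and
  \<open>tree_label\<close> undoes the copying.\<close>

lemma match_poly_path_tree_tree:
  fixes G :: "'v ugraph"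
  assumes "is_tree G"
  shows "match_poly tree_label (edges (path_tree G v)) =
      (match_poly (\<lambda>u. u) (edges G) :: ('v, 'c::comm_ring_1) mpoly)" (is ?P)
    and "match_poly tree_label (avoid (edges (path_tree G v)) (Node v)) =
      (match_poly (\<lambda>u. u) (avoid (edges G) v) :: ('v, 'c) mpoly)" (is ?Q)
proof -
  have T: "edges (path_tree G v) = (`) Node ` edges G"
    using assms by (simp add: path_tree.simps map_graph_def)
  have "avoid ((`) Node ` edges G) (Node v) = (`) Node ` avoid (edges G) v"
    by (auto simp: avoid_def)
  moreover have "inj (Node :: 'v \<Rightarrow> _)" "tree_label \<circ> Node = (\<lambda>u :: 'v. u)" by (auto simp: inj_def)
  ultimately show ?P ?Q
    by (simp_all add: T match_poly_image)
qed

lemma match_poly_path_tree_avoid_root: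
  assumes "simple_graph G" "v \<in> verts G" "\<not> is_tree G"
  shows "match_poly tree_label (avoid (edges (path_tree G v)) (Node v)) =
    (\<Prod>w\<in>neighbours G v. match_poly tree_label (edges (path_tree (G \<setminus> v) w)))"
  unfolding path_tree_not_tree[OF assms] edges_join_branches_avoid_root
  using finite_nbrs[OF edge_set_edges[OF assms(1)], of v] edge_set_path_tree_nbr[OF assms(1)]
  by (intro match_poly_branches) (auto simp: neighbours_def)

text \<open>The identity of the fractions in multiplied-out form, which holds over every commutative
  ring since no cancellation occurs.\<close>

lemma match_poly_path_tree_ratio:
  fixes G :: "'v ugraph"
  assumes "simple_graph G" "v \<in> verts G"
  shows "match_poly (\<lambda>u. u) (edges G) * match_poly tree_label (avoid (edges (path_tree G v)) (Node v)) =
    (match_poly tree_label (edges (path_tree G v)) * match_poly (\<lambda>u. u) (avoid (edges G) v)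
      :: ('v, 'c::comm_ring_1) mpoly)"
  using assms
proof (induction rule: path_tree_induct)
  case (tree G v)
  thus ?case by (simp add: match_poly_path_tree_tree)
next
  case (branch G v)
  let ?m = "\<lambda>E. match_poly (\<lambda>u. u) E :: ('v, 'c) mpoly"
  let ?t = "\<lambda>E. match_poly tree_label E :: ('v, 'c) mpoly"
  let ?N = "neighbours G v"
  let ?E = "edges G"
  let ?T = "\<lambda>w. edges (path_tree (G \<setminus> v) w)"
  let ?P = "\<Prod>w\<in>?N. ?t (?T w)"
  have E: "edge_set ?E" using branch.hyps(1) by (rule edge_set_edges)
  have N: "finite ?N" using finite_nbrs[OF E] by (simp add: neighbours_def)
  have IH: "?m (avoid ?E v) * ?t (avoid (?T w) (Node w)) = ?t (?T w) * ?m (avoid (avoid ?E v) w)"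
    if "w \<in> ?N" for w
    using branch.IH[OF that] by (simp add: edges_del_vertex)
  have "?t (edges (path_tree G v)) = ?P -
      (\<Sum>w\<in>?N. Var v * Var w * (?t (avoid (?T w) (Node w)) * (\<Prod>x\<in>?N - {w}. ?t (?T x))))"
    unfolding path_tree_not_tree[OF branch.hyps]
    using N edge_set_path_tree_nbr[OF branch.hyps(1)] edge_set_path_tree[OF branch.hyps(1,2)]
    by (intro match_poly_join_branches) (auto simp: path_tree_not_tree[OF branch.hyps])
  \<comment> \<open>The new factor is what the induction hypothesis needs: in each summand it
    restores the missing factor of branch \<open>w\<close>, so that \<open>?P\<close> can be taken
    out and the expansion of \<open>G\<close> at \<open>v\<close> remains.\<close>
  hence "?t (edges (path_tree G v)) * ?m (avoid ?E v) = ?P * ?m (avoid ?E v) -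
      (\<Sum>w\<in>?N. Var v * Var w * (?t (avoid (?T w) (Node w)) * (\<Prod>x\<in>?N - {w}. ?t (?T x))) * ?m (avoid ?E v))"
    by (simp add: left_diff_distrib sum_distrib_right)
  also have "(\<Sum>w\<in>?N. Var v * Var w * (?t (avoid (?T w) (Node w)) * (\<Prod>x\<in>?N - {w}. ?t (?T x))) * ?m (avoid ?E v))
      = (\<Sum>w\<in>?N. ?P * (Var v * Var w * ?m (avoid (avoid ?E v) w)))"
  proof (rule sum.cong[OF refl])
    fix w assume w: "w \<in> ?N"
    let ?Q = "\<Prod>x\<in>?N - {w}. ?t (?T x)"
    have "Var v * Var w * (?t (avoid (?T w) (Node w)) * ?Q) * ?m (avoid ?E v) =
        Var v * Var w * ?Q * (?m (avoid ?E v) * ?t (avoid (?T w) (Node w)))"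
      by (simp add: ac_simps)
    also have "\<dots> = (?t (?T w) * ?Q) * (Var v * Var w * ?m (avoid (avoid ?E v) w))"
      by (simp only: IH[OF w] ac_simps)
    also have "?t (?T w) * ?Q = ?P" using N w by (rule prod.remove[symmetric])
    finally show "Var v * Var w * (?t (avoid (?T w) (Node w)) * ?Q) * ?m (avoid ?E v) =
        ?P * (Var v * Var w * ?m (avoid (avoid ?E v) w))" .
  qed
  also have "?P * ?m (avoid ?E v) - \<dots> = ?P * ?m ?E"
    unfolding match_poly_expand[OF E, of "\<lambda>u. u" v]
    by (simp add: right_diff_distrib sum_distrib_left neighbours_def)
  finally show ?case
    by (simp add: match_poly_path_tree_avoid_root[OF branch.hyps] mult.commute)
qed

text \<open>The coefficients form an integral domain here because nonzero polynomials get cancelled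
  twice.\<close>

lemma match_poly_component_dvd_path_tree:
  fixes G :: "'v ugraph"
  assumes "simple_graph G" "v \<in> verts G"
  shows "(match_poly (\<lambda>u. u) (component (edges G) v) :: ('v, 'c::idom) mpoly) dvd
    match_poly tree_label (edges (path_tree G v))"
  using assms
proof (induction rule: path_tree_induct)
  case (tree G v)
  thus ?case by (simp add: match_poly_path_tree_tree component_connected_graph is_tree_def)
next
  case (branch G v)
  let ?m = "\<lambda>E. match_poly (\<lambda>u. u) E :: ('v, 'c) mpoly"
  let ?t = "\<lambda>E. match_poly tree_label E :: ('v, 'c) mpoly"
  let ?E = "edges G"
  let ?T = "edges (path_tree G v)"
  let ?C = "component ?E v"
  let ?R = "?E - ?C"
  have E: "edge_set ?E" using branch.hyps(1) by (rule edge_set_edges)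
  have C: "edge_set ?C" using E component_subset by (rule edge_set_subset)
  have R: "edge_set ?R" using E Diff_subset by (rule edge_set_subset)
  have disj: "\<Union>?C \<inter> \<Union>?R = {}" using E by (rule component_rest_disjoint)
  have split: "?m ?E = ?m ?C * ?m ?R"
  proof -
    have "?E = ?C \<union> ?R" using component_subset[of ?E v] by blast
    thus ?thesis using match_poly_Un[OF C R disj] by metis
  qed
  have split_avoid: "?m (avoid ?E v) = ?m (avoid ?C v) * ?m ?R"
  proof -
    \<comment> \<open>Every edge at \<open>v\<close> lies in \<open>?C\<close>, so deleting
      \<open>v\<close> leaves \<open>?R\<close> untouched.\<close>
    have "avoid ?E v = avoid ?C v \<union> ?R"
      using reach_refl[of v ?E] by (auto simp: avoid_def component_def)
    moreover have "\<Union>(avoid ?C v) \<inter> \<Union>?R = {}" using disj avoid_subset[of ?C v] by blast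
    ultimately show ?thesis using match_poly_Un[OF edge_set_avoid[OF C] R] by metis
  qed
  \<comment> \<open>The other components contribute the same factor to both sides; cancelling it
    turns the ratio identity for \<open>G\<close> into one for \<open>?C\<close>.\<close>
  have "(?m ?C * ?t (avoid ?T (Node v))) * ?m ?R = (?t ?T * ?m (avoid ?C v)) * ?m ?R"
    using match_poly_path_tree_ratio[OF branch.hyps(1,2), where 'c='c]
    unfolding split split_avoid by (simp only: mult.assoc mult.commute mult.left_commute)
  hence ratio: "?m ?C * ?t (avoid ?T (Node v)) = ?t ?T * ?m (avoid ?C v)"
    using match_poly_neq_0[OF R] by (metis mult_right_cancel)
  have "?m (avoid ?C v) dvd ?t (avoid ?T (Node v))"
    unfolding match_poly_path_tree_avoid_root[OF branch.hyps] neighbours_def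
    using E branch.IH by (intro match_poly_component_avoid_dvd) (simp_all add: neighbours_def edges_del_vertex)
  then obtain k where k: "?t (avoid ?T (Node v)) = ?m (avoid ?C v) * k" by (elim dvdE)
  \<comment> \<open>The cofactor \<open>k\<close> of the deleted graphs is also the cofactor of the
    full ones, once the polynomial of \<open>avoid ?C v\<close> is cancelled.\<close>
  have "?m (avoid ?C v) * ?t ?T = ?m (avoid ?C v) * (?m ?C * k)"
    using ratio[symmetric] unfolding k by (simp only: mult.assoc mult.commute mult.left_commute)
  hence "?t ?T = ?m ?C * k"
    using match_poly_neq_0[OF edge_set_avoid[OF C]] by (metis mult_left_cancel)
  thus ?case by (rule dvdI)
qed

theorem theorem4p1:
  fixes G :: "'v ugraph" and v :: 'v
  assumes "simple_graph G" and "v \<in> verts G"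
  shows "(Fract (vertex_matching_poly G) (vertex_matching_poly (G \<setminus> v))
            :: ('v, 'c::idom) mpoly fract) =
         Fract (rel_vertex_matching_poly tree_label (path_tree G v))
               (rel_vertex_matching_poly tree_label (path_tree G v \<setminus> tree_root v))
       \<and> (connected_graph G \<longrightarrow>
           (vertex_matching_poly G :: ('v, 'c) mpoly) dvd
             rel_vertex_matching_poly tree_label (path_tree G v))"
proof (intro conjI impI)
  \<comment> \<open>Nonzero denominators reduce equality of the fractions to cross
    multiplication.\<close>
  have nz: "match_poly (\<lambda>u. u) (avoid (edges G) v) \<noteq> (0 :: ('v, 'c) mpoly)"
    "match_poly tree_label (avoid (edges (path_tree G v)) (Node v)) \<noteq> (0 :: ('v, 'c) mpoly)"
    using assms by (simp_all add: match_poly_neq_0 edge_set_avoid edge_set_edges edge_set_path_tree)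
  show "(Fract (vertex_matching_poly G) (vertex_matching_poly (G \<setminus> v)) :: ('v, 'c) mpoly fract) =
      Fract (rel_vertex_matching_poly tree_label (path_tree G v))
        (rel_vertex_matching_poly tree_label (path_tree G v \<setminus> tree_root v))"
    using nz match_poly_path_tree_ratio[OF assms, where 'c='c]
    by (simp add: vertex_matching_poly_eq_rel rel_vertex_matching_poly_eq edges_del_vertex eq_fract)
next
  assume "connected_graph G"
  thus "(vertex_matching_poly G :: ('v, 'c) mpoly) dvd
      rel_vertex_matching_poly tree_label (path_tree G v)"
    using match_poly_component_dvd_path_tree[OF assms, where 'c='c] component_connected_graph[OF assms(1) _ assms(2)]
    by (simp add: vertex_matching_poly_eq_rel rel_vertex_matching_poly_eq)
qed

end
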